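(* For a row $i\in\{1,\dots,m\}$ let $\alpha_i^-:=\min_jA_{ij}$ and $\alpha_i^+:=\max_jA_{ij}$ (over all $j=1,\dots,n$, zeros included), and define $$\mu_i:=(\alpha_i^-+\alpha_i^+)b_i-\alpha_i^-\alpha_i^+,\qquad \bar H_i^{\rm rng}:=\mu_i/\gamma.$$ Then $$0\le H^\star_{ii}\le\bar H_i^{\rm rng}\le\|A_{i:}\|_\infty^2/\gamma,$$ so $\kappa_i=2\log2\,\bar H_i^{\rm rng}$ and $\nu_i=2\|A_{i:}\|_\infty^2/\gamma^2$, which are computable from $A,b,\gamma$ without sign orientation of the rows and without knowledge of the primal solution $x^\star$, are valid constants: $\partial_{ii}^2\phi_{\rm se}(\lambda)\le\kappa_i+\nu_iF(\lambda)$ for all $\lambda\in\mathbb R^m$. If $\alpha_i^-=0$ then $\bar H_i^{\rm rng}=\|A_{i:}\|_\infty b_i/\gamma$.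
   Context: Let $A\in\mathbb R^{m\times n}$ with columns $a_1,\dots,a_n$ and rows $A_{i:}$, $b\in\mathbb R^m$, $c\in\mathbb R^n$, $\gamma>0$. Standing assumption: there is $q\in\mathbb R^m$ with $A^\top q=\mathbf 1$ and $\langle q,b\rangle=1$, and there is $\bar x>0$ (entrywise) with $A\bar x=b$. The primal problem is $\min_{x\ge0}\{\langle c,x\rangle+\gamma\sum_jx_j(\log x_j-1):Ax=b,\ \mathbf 1^\top x=1\}$ with unique solution $x^\star$. The sum-exp dual is $\phi_{\rm se}(\lambda)=-\langle b,\lambda\rangle+\gamma\sum_j\exp((a_j^\top\lambda-c_j)/\gamma)$; its minimum $\phi_{\rm se}^\star$ is attained, $F=\phi_{\rm se}-\phi_{\rm se}^\star$, and $H^\star=\nabla^2\phi_{\rm se}(\lambda^\star)$ at a minimizer $\lambda^\star$ (the same matrix for every minimizer). $\|A_{i:}\|_\infty=\max_j|A_{ij}|$. *)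

theory Defs
  imports "HOL-Analysis.Analysis"
begin

definition partial_deriv :: "'m::finite \<Rightarrow> (real ^ 'm \<Rightarrow> real) \<Rightarrow> real ^ 'm \<Rightarrow> real" where
  "partial_deriv i f x = deriv (\<lambda>t. f (x + t *\<^sub>R axis i 1)) 0"

definition hessian :: "(real ^ 'm \<Rightarrow> real) \<Rightarrow> real ^ 'm \<Rightarrow> real ^ 'm ^ 'm::finite" where
  "hessian f x = (\<chi> i j. partial_deriv i (partial_deriv j f) x)"

definition standing_assumption :: "real ^ 'n ^ 'm \<Rightarrow> real ^ 'm \<Rightarrow> bool" where
  "standing_assumption A b \<longleftrightarrow>
     (\<exists>q. transpose A *v q = 1 \<and> q \<bullet> b = 1) \<and>
     (\<exists>x. (\<forall>j. 0 < x $ j) \<and> A *v x = b)"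

definition sum_exp_dual ::
  "real ^ 'n ^ 'm \<Rightarrow> real ^ 'm \<Rightarrow> real ^ 'n \<Rightarrow> real \<Rightarrow> real ^ 'm \<Rightarrow> real" where
  "sum_exp_dual A b c \<gamma> l =
     - (b \<bullet> l) + \<gamma> * (\<Sum>j\<in>UNIV. exp ((column j A \<bullet> l - c $ j) / \<gamma>))"

(* The infimum over all of real^'m; under the standing assumption it is a minimum. *)
definition dual_gap ::
  "real ^ 'n ^ 'm \<Rightarrow> real ^ 'm \<Rightarrow> real ^ 'n \<Rightarrow> real \<Rightarrow> real ^ 'm \<Rightarrow> real" where
  "dual_gap A b c \<gamma> l = sum_exp_dual A b c \<gamma> l - (INF l'. sum_exp_dual A b c \<gamma> l')"

definition row_min :: "real ^ 'n ^ 'm \<Rightarrow> 'm \<Rightarrow> real" where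
  "row_min A i = Min (range (\<lambda>j. A $ i $ j))"

definition row_max :: "real ^ 'n ^ 'm \<Rightarrow> 'm \<Rightarrow> real" where
  "row_max A i = Max (range (\<lambda>j. A $ i $ j))"

definition range_mu :: "real ^ 'n ^ 'm \<Rightarrow> real ^ 'm \<Rightarrow> 'm \<Rightarrow> real" where
  "range_mu A b i = (row_min A i + row_max A i) * b $ i - row_min A i * row_max A i"

definition H_rng :: "real ^ 'n ^ 'm \<Rightarrow> real ^ 'm \<Rightarrow> real \<Rightarrow> 'm \<Rightarrow> real" where
  "H_rng A b \<gamma> i = range_mu A b i / \<gamma>"

definition kappa :: "real ^ 'n ^ 'm \<Rightarrow> real ^ 'm \<Rightarrow> real \<Rightarrow> 'm \<Rightarrow> real" where
  "kappa A b \<gamma> i = 2 * ln 2 * H_rng A b \<gamma> i"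

definition nu :: "real ^ 'n ^ 'm \<Rightarrow> real \<Rightarrow> 'm \<Rightarrow> real" where
  "nu A \<gamma> i = 2 * (infnorm (row i A))\<^sup>2 / \<gamma>\<^sup>2"

end

theory Submission
  imports Defs
begin

text \<open>
  Write \<open>p j\<close> for the exponential of \<open>(a\<^sub>j \<bullet> l - c\<^sub>j) / \<gamma>\<close>.  The gradient of the dual is \<open>A p - b\<close>, so at
  a minimizer \<open>A p = b\<close>; pairing this with the vector \<open>q\<close> of the standing assumption shows
  that \<open>p\<close> sums to one.  Hence \<open>\<gamma>\<close> times the \<open>i\<close>-th diagonal entry of the Hessian is the
  second moment, and \<open>b\<^sub>i\<close> the mean, of the \<open>i\<close>-th row under a probability vector.  Summing
  \<open>(A\<^sub>i\<^sub>j - \<alpha>\<^sup>-) (A\<^sub>i\<^sub>j - \<alpha>\<^sup>+) \<le> 0\<close> against that vector gives the range bound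
  (\<open>second_moment_le_range\<close>).  The range bound is affine in the mean and equals a square of
  \<open>\<alpha>\<^sup>-\<close> or \<open>\<alpha>\<^sup>+\<close> at the endpoints, so it is at most the squared supremum norm.

  For the global bound fix a minimizer \<open>s\<close> and let \<open>u\<^sub>j = a\<^sub>j \<bullet> (l - s) / \<gamma>\<close>.  Because
  \<open>A p = b\<close> at \<open>s\<close>, the linear part of the dual can be absorbed into the sum over \<open>j\<close>, and the
  gap is \<open>\<gamma>\<close> times the \<open>p\<close>-average at \<open>s\<close> of \<open>exp u - 1 - u\<close> (\<open>sum_exp_dual_diff\<close>).  The scalar
  inequality \<open>exp u \<le> 2 ln 2 + 2 (exp u - 1 - u)\<close>, averaged with the weights \<open>A\<^sub>i\<^sub>j\<^sup>2 p\<^sub>j\<close>,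
  compares the Hessian at \<open>l\<close> with the Hessian at \<open>s\<close> and the gap.

  The gap is defined by an infimum, so a minimizer has to be produced.  As \<open>b = A x\<close> with
  \<open>x > 0\<close>, the dual is a function of \<open>y = A\<^sup>T l\<close> that separates over coordinates into terms
  \<open>\<gamma> exp ((y\<^sub>j - c\<^sub>j) / \<gamma>) - x\<^sub>j y\<^sub>j\<close>, each tending to infinity in both directions.  This
  function is coercive, and it attains its minimum on the closed subspace \<open>range A\<^sup>T\<close>
  (\<open>sum_exp_dual_attains_min\<close>).
\<close>

definition dual_weights :: "real ^ 'n ^ 'm \<Rightarrow> real ^ 'n \<Rightarrow> real \<Rightarrow> real ^ 'm \<Rightarrow> real ^ 'n" where
  "dual_weights A c \<gamma> l = (\<chi> j. exp ((column j A \<bullet> l - c $ j) / \<gamma>))"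

section \<open>Averages over the columns\<close>

lemma matrix_vector_inner_columns:
  fixes A :: "real ^ 'n ^ 'm"
  shows "(A *v x) \<bullet> v = (\<Sum>j\<in>UNIV. x $ j * (column j A \<bullet> v))"
proof -
  have "(A *v x) \<bullet> v = (\<Sum>i\<in>UNIV. \<Sum>j\<in>UNIV. A $ i $ j * x $ j * v $ i)"
    by (simp add: inner_vec_def matrix_vector_mult_def sum_distrib_right)
  also have "\<dots> = (\<Sum>j\<in>UNIV. \<Sum>i\<in>UNIV. A $ i $ j * x $ j * v $ i)"
    by (rule sum.swap)
  also have "\<dots> = (\<Sum>j\<in>UNIV. x $ j * (column j A \<bullet> v))"
    by (simp add: inner_vec_def column_def sum_distrib_left mult_ac)
  finally show ?thesis .
qed

lemma transpose_mult_component: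
  fixes A :: "real ^ 'n ^ 'm"
  shows "(transpose A *v l) $ j = column j A \<bullet> l"
  by (simp add: matrix_vector_mult_def transpose_def column_def inner_vec_def)

text \<open>The vector \<open>q\<close> of the standing assumption makes the normalization \<open>\<Sum>j. x\<^sub>j = 1\<close> a
  consequence of the linear system.\<close>

lemma standing_assumption_sum_eq_1:
  assumes "standing_assumption A b" and "A *v x = b"
  shows "(\<Sum>j\<in>UNIV. x $ j) = 1"
proof -
  obtain q where q: "transpose A *v q = 1" "q \<bullet> b = 1"
    using assms(1) by (auto simp: standing_assumption_def)
  have "column j A \<bullet> q = 1" for j
    using q(1) transpose_mult_component[of A q j] by simp
  then have "(A *v x) \<bullet> q = (\<Sum>j\<in>UNIV. x $ j)"
    by (simp add: matrix_vector_inner_columns)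
  with q(2) assms(2) show ?thesis by (simp add: inner_commute)
qed

text \<open>This is the Bhatia--Davis inequality, written for the second moment instead of the
  variance.\<close>

lemma second_moment_le_range:
  fixes p f :: "'a \<Rightarrow> real"
  assumes "\<And>j. j \<in> S \<Longrightarrow> 0 \<le> p j" and "sum p S = 1"
    and "\<And>j. j \<in> S \<Longrightarrow> lo \<le> f j \<and> f j \<le> hi"
  shows "(\<Sum>j\<in>S. p j * (f j)\<^sup>2) \<le> (lo + hi) * (\<Sum>j\<in>S. p j * f j) - lo * hi"
proof -
  have "(f j)\<^sup>2 \<le> (lo + hi) * f j - lo * hi" if "j \<in> S" for j
  proof -
    have "0 \<le> (f j - lo) * (hi - f j)"
      using assms(3)[OF that] by simp
    then show ?thesis by (simp add: algebra_simps power2_eq_square)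
  qed
  then have "(\<Sum>j\<in>S. p j * (f j)\<^sup>2) \<le> (\<Sum>j\<in>S. p j * ((lo + hi) * f j - lo * hi))"
    by (intro sum_mono mult_left_mono assms(1))
  also have "\<dots> = (lo + hi) * (\<Sum>j\<in>S. p j * f j) - sum p S * (lo * hi)"
    by (simp add: right_diff_distrib sum_subtractf sum_distrib_left sum_distrib_right mult_ac)
  finally show ?thesis using assms(2) by simp
qed

lemma average_in_range:
  fixes p f :: "'a \<Rightarrow> real"
  assumes "\<And>j. j \<in> S \<Longrightarrow> 0 \<le> p j" and "sum p S = 1"
    and "\<And>j. j \<in> S \<Longrightarrow> lo \<le> f j \<and> f j \<le> hi"
  shows "lo \<le> (\<Sum>j\<in>S. p j * f j)" and "(\<Sum>j\<in>S. p j * f j) \<le> hi"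
proof -
  have "(\<Sum>j\<in>S. p j * lo) \<le> (\<Sum>j\<in>S. p j * f j)"
    using assms by (intro sum_mono mult_left_mono) auto
  then show "lo \<le> (\<Sum>j\<in>S. p j * f j)"
    by (simp flip: sum_distrib_right add: assms(2))
  have "(\<Sum>j\<in>S. p j * f j) \<le> (\<Sum>j\<in>S. p j * hi)"
    using assms by (intro sum_mono mult_left_mono) auto
  then show "(\<Sum>j\<in>S. p j * f j) \<le> hi"
    by (simp flip: sum_distrib_right add: assms(2))
qed

lemma range_bound_le_square:
  fixes lo hi m M :: real
  assumes "lo \<le> m" "m \<le> hi" "\<bar>lo\<bar> \<le> M" "\<bar>hi\<bar> \<le> M"
  shows "(lo + hi) * m - lo * hi \<le> M\<^sup>2"
proof (cases "0 \<le> lo + hi")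
  case True
  then have "(lo + hi) * m \<le> (lo + hi) * hi"
    using assms by (intro mult_left_mono) auto
  moreover have "hi\<^sup>2 \<le> M\<^sup>2"
    using assms by (simp add: abs_le_square_iff[symmetric])
  ultimately show ?thesis by (simp add: algebra_simps power2_eq_square)
next
  case False
  then have "(lo + hi) * m \<le> (lo + hi) * lo"
    using assms by (intro mult_left_mono_neg) auto
  moreover have "lo\<^sup>2 \<le> M\<^sup>2"
    using assms by (simp add: abs_le_square_iff[symmetric])
  ultimately show ?thesis by (simp add: algebra_simps power2_eq_square)
qed

lemma row_min_le: "row_min A i \<le> A $ i $ j"
  and row_max_ge: "A $ i $ j \<le> row_max A i"
  by (simp_all add: row_min_def row_max_def)

lemma row_min_attained: "\<exists>j. row_min A i = A $ i $ j"
  and row_max_attained: "\<exists>j. row_max A i = A $ i $ j"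
proof -
  have "row_min A i \<in> range (\<lambda>j. A $ i $ j)" "row_max A i \<in> range (\<lambda>j. A $ i $ j)"
    unfolding row_min_def row_max_def by (intro Min_in Max_in; simp)+
  then show "\<exists>j. row_min A i = A $ i $ j" "\<exists>j. row_max A i = A $ i $ j"
    by blast+
qed

lemma abs_entry_le_infnorm_row: "\<bar>A $ i $ j\<bar> \<le> infnorm (row i A)"
  using component_le_infnorm_cart[of "row i A" j] by (simp add: row_def)

lemma infnorm_row_eq_row_max:
  assumes "row_min A i = 0"
  shows "infnorm (row i A) = row_max A i"
proof (rule antisym)
  have "0 \<le> A $ i $ j" for j
    using row_min_le[of A i j] assms by simp
  then have "\<bar>A $ i $ j\<bar> \<le> row_max A i" for j
    using row_max_ge[of A i j] by simp
  then show "infnorm (row i A) \<le> row_max A i"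
    unfolding infnorm_cart by (intro cSup_least) (auto simp: row_def)
  obtain k where "row_max A i = A $ i $ k"
    using row_max_attained by blast
  then show "row_max A i \<le> infnorm (row i A)"
    using abs_entry_le_infnorm_row[of A i k] by simp
qed

section \<open>Derivatives of the dual\<close>

lemma exp_affine_has_derivative:
  fixes z a d \<gamma> :: real
  assumes "\<gamma> \<noteq> 0"
  shows "((\<lambda>t. exp ((z + t * a - d) / \<gamma>)) has_real_derivative exp ((z - d) / \<gamma>) * (a / \<gamma>)) (at 0)"
  using assms by (auto intro!: derivative_eq_intros)

lemma sum_exp_dual_has_partial_derivative:
  assumes "\<gamma> \<noteq> 0"
  shows "((\<lambda>t. sum_exp_dual A b c \<gamma> (l + t *\<^sub>R axis i 1)) has_real_derivative
    (A *v dual_weights A c \<gamma> l - b) $ i) (at 0)"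
proof -
  have *: "sum_exp_dual A b c \<gamma> (l + t *\<^sub>R axis i 1) =
    - (b \<bullet> l + t * b $ i) +
    \<gamma> * (\<Sum>j\<in>UNIV. exp ((column j A \<bullet> l + t * A $ i $ j - c $ j) / \<gamma>))" for t
    by (simp add: sum_exp_dual_def inner_add_right inner_axis column_def)
  have "((\<lambda>t. - (b \<bullet> l + t * b $ i)) has_real_derivative - b $ i) (at 0)"
    by (auto intro!: derivative_eq_intros)
  moreover have "((\<lambda>t. \<gamma> * (\<Sum>j\<in>UNIV. exp ((column j A \<bullet> l + t * A $ i $ j - c $ j) / \<gamma>)))
    has_real_derivative
      \<gamma> * (\<Sum>j\<in>UNIV. exp ((column j A \<bullet> l - c $ j) / \<gamma>) * (A $ i $ j / \<gamma>))) (at 0)"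
    by (intro DERIV_cmult DERIV_sum exp_affine_has_derivative assms)
  moreover have "- b $ i +
      \<gamma> * (\<Sum>j\<in>UNIV. exp ((column j A \<bullet> l - c $ j) / \<gamma>) * (A $ i $ j / \<gamma>)) =
    (A *v dual_weights A c \<gamma> l - b) $ i"
    using assms
    by (simp add: matrix_vector_mult_def dual_weights_def sum_distrib_left mult.commute)
  ultimately show ?thesis
    unfolding * using DERIV_add by fastforce
qed

lemma partial_deriv_sum_exp_dual:
  assumes "\<gamma> \<noteq> 0"
  shows "partial_deriv i (sum_exp_dual A b c \<gamma>) l = (A *v dual_weights A c \<gamma> l - b) $ i"
  unfolding partial_deriv_def
  by (rule DERIV_imp_deriv, rule sum_exp_dual_has_partial_derivative[OF assms])

lemma partial_deriv_twice_sum_exp_dual: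
  assumes "\<gamma> \<noteq> 0"
  shows "partial_deriv i (partial_deriv i (sum_exp_dual A b c \<gamma>)) l =
    (\<Sum>j\<in>UNIV. dual_weights A c \<gamma> l $ j * (A $ i $ j)\<^sup>2) / \<gamma>"
proof -
  have *: "partial_deriv i (sum_exp_dual A b c \<gamma>) (l + t *\<^sub>R axis i 1) =
    (\<Sum>j\<in>UNIV. A $ i $ j * exp ((column j A \<bullet> l + t * A $ i $ j - c $ j) / \<gamma>)) - b $ i" for t
    by (simp add: partial_deriv_sum_exp_dual[OF assms] matrix_vector_mult_def dual_weights_def
        inner_add_right inner_axis column_def)
  have "((\<lambda>t. partial_deriv i (sum_exp_dual A b c \<gamma>) (l + t *\<^sub>R axis i 1)) has_real_derivative
    (\<Sum>j\<in>UNIV. dual_weights A c \<gamma> l $ j * (A $ i $ j)\<^sup>2) / \<gamma>) (at 0)"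
  proof -
    have "((\<lambda>t. (\<Sum>j\<in>UNIV. A $ i $ j * exp ((column j A \<bullet> l + t * A $ i $ j - c $ j) / \<gamma>)) - b $ i)
      has_real_derivative
        (\<Sum>j\<in>UNIV. A $ i $ j * (exp ((column j A \<bullet> l - c $ j) / \<gamma>) * (A $ i $ j / \<gamma>))) - 0) (at 0)"
      by (intro DERIV_diff DERIV_const DERIV_cmult DERIV_sum exp_affine_has_derivative assms)
    then show ?thesis
      unfolding *
      by (simp add: dual_weights_def sum_divide_distrib power2_eq_square mult_ac)
  qed
  then show ?thesis
    unfolding partial_deriv_def[of i "partial_deriv i (sum_exp_dual A b c \<gamma>)"]
    by (rule DERIV_imp_deriv)
qed

lemma minimizer_weights_feasible:
  assumes "\<gamma> \<noteq> 0" and min: "\<And>l. sum_exp_dual A b c \<gamma> s \<le> sum_exp_dual A b c \<gamma> l"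
  shows "A *v dual_weights A c \<gamma> s = b"
proof -
  have "(A *v dual_weights A c \<gamma> s - b) $ i = 0" for i
    by (rule DERIV_local_min[OF sum_exp_dual_has_partial_derivative[OF assms(1)] zero_less_one])
      (simp add: min)
  then show ?thesis by (simp add: vec_eq_iff)
qed

section \<open>Existence of a minimizer\<close>

text \<open>The function \<open>exp t - x * t\<close> lies above the two lines obtained from the tangents of \<open>exp\<close>
  with slopes \<open>2 x\<close> and \<open>x / 2\<close>; one of them grows to the right and the other to the left.\<close>

lemma exp_minus_linear_coercive:
  fixes x :: real
  assumes "0 < x"
  obtains C where "\<And>t. x / 2 * \<bar>t\<bar> - C \<le> exp t - x * t"
proof -
  have tangent: "K + K * (t - ln K) \<le> exp t" if "0 < K" for K t :: real
  proof -
    have "K * (1 + (t - ln K)) \<le> K * exp (t - ln K)"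
      using that by (intro mult_left_mono exp_ge_add_one_self) auto
    also have "\<dots> = exp t" using that by (simp add: exp_diff)
    finally show ?thesis by (simp add: algebra_simps)
  qed
  define k1 k2 where "k1 = 2 * x - 2 * x * ln (2 * x)" and "k2 = x / 2 - x / 2 * ln (x / 2)"
  have "x / 2 * \<bar>t\<bar> - (\<bar>k1\<bar> + \<bar>k2\<bar>) \<le> exp t - x * t" for t
  proof (cases "0 \<le> t")
    case True
    have "0 \<le> x * t" using assms True by simp
    moreover have "k1 + 2 * (x * t) \<le> exp t"
      using assms tangent[of "2 * x" t] by (simp add: k1_def algebra_simps)
    ultimately show ?thesis using True by simp
  next
    case False
    have "k2 + x * t / 2 \<le> exp t"
      using assms tangent[of "x / 2" t] by (simp add: k2_def algebra_simps)
    then show ?thesis using False by simp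
  qed
  then show thesis by (rule that)
qed

text \<open>The dual itself is constant along the kernel of \<open>A\<^sup>T\<close> and so need not be coercive in \<open>l\<close>.
  The bound is therefore taken in \<open>y = A\<^sup>T l\<close>, where positivity of every \<open>x\<^sub>j\<close> bounds the
  sublevel set of the level at \<open>y = 0\<close>.\<close>

lemma sum_exp_dual_attains_min:
  fixes A :: "real ^ 'n ^ 'm" and c :: "real ^ 'n"
  assumes \<gamma>: "0 < \<gamma>" and x: "\<And>j. 0 < x $ j" and b: "A *v x = b"
  obtains s where "\<And>l. sum_exp_dual A b c \<gamma> s \<le> sum_exp_dual A b c \<gamma> l"
proof -
  define g where
    "g y = (\<Sum>j\<in>UNIV. \<gamma> * exp ((y $ j - c $ j) / \<gamma>) - x $ j * y $ j)" for y :: "real ^ 'n"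
  have dual_g: "sum_exp_dual A b c \<gamma> l = g (transpose A *v l)" for l
    unfolding sum_exp_dual_def g_def b[symmetric] matrix_vector_inner_columns
    by (simp add: transpose_mult_component sum_subtractf sum_distrib_left
        del: transpose_matrix_vector)
  have "\<exists>C. \<forall>t. x $ j / 2 * \<bar>t\<bar> - C \<le> exp t - x $ j * t" for j
    by (rule exp_minus_linear_coercive[OF x[of j]]) blast
  then obtain C where C: "x $ j / 2 * \<bar>t\<bar> - C j \<le> exp t - x $ j * t" for j t
    by metis
  define d where "d = Min (range (\<lambda>j. x $ j / 2))"
  have d_pos: "0 < d" unfolding d_def using x by (subst Min_gr_iff) auto
  have d_le: "d \<le> x $ j / 2" for j unfolding d_def by (rule Min_le) auto
  define K where "K = (\<Sum>j\<in>UNIV. \<gamma> * C j + x $ j * c $ j)"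
  have coercive: "d * norm (y - c) \<le> g y + K" for y
  proof -
    have coord: "d * \<bar>y $ j - c $ j\<bar> \<le>
      (\<gamma> * exp ((y $ j - c $ j) / \<gamma>) - x $ j * y $ j) + (\<gamma> * C j + x $ j * c $ j)" for j
    proof -
      define t where "t = (y $ j - c $ j) / \<gamma>"
      have y: "y $ j = c $ j + \<gamma> * t" using \<gamma> by (simp add: t_def)
      have "\<gamma> * (d * \<bar>t\<bar>) \<le> \<gamma> * (x $ j / 2 * \<bar>t\<bar>)"
        using \<gamma> d_le[of j] by (intro mult_left_mono mult_right_mono) auto
      also have "\<dots> \<le> \<gamma> * (exp t - x $ j * t + C j)"
        using C[of j t] \<gamma> by (intro mult_left_mono) auto
      finally show ?thesis
        using \<gamma> unfolding y by (simp add: abs_mult algebra_simps)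
    qed
    have "d * norm (y - c) \<le> d * (\<Sum>j\<in>UNIV. \<bar>(y - c) $ j\<bar>)"
      using d_pos by (intro mult_left_mono norm_le_l1_cart) auto
    also have "\<dots> = (\<Sum>j\<in>UNIV. d * \<bar>y $ j - c $ j\<bar>)"
      by (simp add: sum_distrib_left)
    also have "\<dots> \<le> g y + K"
      unfolding g_def K_def sum.distrib[symmetric] by (intro sum_mono coord)
    finally show ?thesis .
  qed
  define S where "S = range (\<lambda>l. transpose A *v l) \<inter> cball c ((g 0 + K) / d)"
  have "subspace (range (\<lambda>l. transpose A *v l))"
    by (intro linear_subspace_image subspace_UNIV matrix_vector_mul_linear)
  then have "compact S"
    unfolding S_def by (intro closed_Int_compact closed_subspace) auto
  have in_S: "transpose A *v l \<in> S" if "g (transpose A *v l) \<le> g 0" for l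
  proof -
    have "d * norm (transpose A *v l - c) \<le> g 0 + K"
      using coercive[of "transpose A *v l"] that by simp
    then show ?thesis
      using d_pos by (simp add: S_def dist_norm norm_minus_commute field_simps)
  qed
  have "0 \<in> S" using in_S[of 0] by simp
  moreover have "continuous_on S g"
    unfolding g_def using \<gamma> by (intro continuous_intros) auto
  ultimately obtain y where y: "y \<in> S" "\<And>z. z \<in> S \<Longrightarrow> g y \<le> g z"
    using continuous_attains_inf[OF \<open>compact S\<close>] by blast
  then obtain s where s: "y = transpose A *v s" by (auto simp: S_def)
  have "sum_exp_dual A b c \<gamma> s \<le> sum_exp_dual A b c \<gamma> l" for l
  proof (cases "g (transpose A *v l) \<le> g 0")
    case True
    then show ?thesis using y(2)[OF in_S] by (simp add: dual_g s)
  next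
    case False
    then show ?thesis using y(2)[OF \<open>0 \<in> S\<close>] by (simp add: dual_g s)
  qed
  then show thesis by (rule that)
qed

section \<open>The Hessian bounds\<close>

text \<open>Feasibility of the weights at \<open>s\<close> turns \<open>b \<bullet> (l - s)\<close> into a weighted sum over the
  columns, leaving the Bregman divergence of \<open>exp\<close>.\<close>

lemma sum_exp_dual_diff:
  assumes "\<gamma> \<noteq> 0" and feas: "A *v dual_weights A c \<gamma> s = b"
  defines "u \<equiv> \<lambda>j l. column j A \<bullet> (l - s) / \<gamma>"
  shows "sum_exp_dual A b c \<gamma> l - sum_exp_dual A b c \<gamma> s =
    \<gamma> * (\<Sum>j\<in>UNIV. dual_weights A c \<gamma> s $ j * (exp (u j l) - 1 - u j l))"
    and "dual_weights A c \<gamma> l $ j = dual_weights A c \<gamma> s $ j * exp (u j l)"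
proof -
  show weights: "dual_weights A c \<gamma> l $ j = dual_weights A c \<gamma> s $ j * exp (u j l)" for j
    by (simp add: dual_weights_def u_def inner_diff_right flip: exp_add add_divide_distrib)
  have dual: "sum_exp_dual A b c \<gamma> l = - (b \<bullet> l) + \<gamma> * (\<Sum>j\<in>UNIV. dual_weights A c \<gamma> l $ j)" for l
    by (simp add: sum_exp_dual_def dual_weights_def)
  have "b \<bullet> (l - s) = (\<Sum>j\<in>UNIV. dual_weights A c \<gamma> s $ j * (column j A \<bullet> (l - s)))"
    by (subst feas[symmetric]) (rule matrix_vector_inner_columns)
  also have "\<dots> = \<gamma> * (\<Sum>j\<in>UNIV. dual_weights A c \<gamma> s $ j * u j l)"
    using assms(1) by (simp add: u_def sum_distrib_left)
  finally have "b \<bullet> l - b \<bullet> s = \<gamma> * (\<Sum>j\<in>UNIV. dual_weights A c \<gamma> s $ j * u j l)"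
    by (simp add: inner_diff_right)
  then show "sum_exp_dual A b c \<gamma> l - sum_exp_dual A b c \<gamma> s =
    \<gamma> * (\<Sum>j\<in>UNIV. dual_weights A c \<gamma> s $ j * (exp (u j l) - 1 - u j l))"
    unfolding dual weights[abs_def]
    by (simp add: right_diff_distrib sum_subtractf)
qed

text \<open>After collecting terms this says that \<open>exp\<close> lies above its tangent at \<open>ln 2\<close>.\<close>

lemma exp_le_bregman: "exp u \<le> 2 * ln 2 + 2 * (exp u - 1 - u)" for u :: real
proof -
  have "2 * (1 + (u - ln 2)) \<le> 2 * exp (u - ln 2)"
    by (intro mult_left_mono exp_ge_add_one_self) auto
  then show ?thesis by (simp add: exp_diff)
qed

lemma second_derivative_le_gap:
  assumes \<gamma>: "0 < \<gamma>" and feas: "A *v dual_weights A c \<gamma> s = b"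
  shows "partial_deriv i (partial_deriv i (sum_exp_dual A b c \<gamma>)) l \<le>
    2 * ln 2 * partial_deriv i (partial_deriv i (sum_exp_dual A b c \<gamma>)) s +
    nu A \<gamma> i * (sum_exp_dual A b c \<gamma> l - sum_exp_dual A b c \<gamma> s)"
proof -
  define p where "p j = dual_weights A c \<gamma> s $ j" for j
  define u where "u j = column j A \<bullet> (l - s) / \<gamma>" for j
  define M where "M = infnorm (row i A)"
  have gap: "sum_exp_dual A b c \<gamma> l - sum_exp_dual A b c \<gamma> s =
      \<gamma> * (\<Sum>j\<in>UNIV. p j * (exp (u j) - 1 - u j))"
    and weights: "dual_weights A c \<gamma> l $ j = p j * exp (u j)" for j
    unfolding p_def u_def
    by (rule sum_exp_dual_diff[OF less_imp_neq[OF \<gamma>, symmetric] feas])+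
  have "p j * exp (u j) * (A $ i $ j)\<^sup>2 \<le>
    2 * ln 2 * (p j * (A $ i $ j)\<^sup>2) + 2 * M\<^sup>2 * (p j * (exp (u j) - 1 - u j))" for j
  proof -
    have p: "0 \<le> p j" by (simp add: p_def dual_weights_def)
    have breg: "0 \<le> exp (u j) - 1 - u j"
      using exp_ge_add_one_self[of "u j"] by linarith
    have sq: "(A $ i $ j)\<^sup>2 \<le> M\<^sup>2"
      using abs_entry_le_infnorm_row[of A i j] by (simp add: M_def abs_le_square_iff[symmetric])
    have "p j * (A $ i $ j)\<^sup>2 * exp (u j) \<le>
      p j * (A $ i $ j)\<^sup>2 * (2 * ln 2 + 2 * (exp (u j) - 1 - u j))"
      using p by (intro mult_left_mono exp_le_bregman) auto
    moreover have "(A $ i $ j)\<^sup>2 * (p j * (exp (u j) - 1 - u j)) \<le>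
      M\<^sup>2 * (p j * (exp (u j) - 1 - u j))"
      using p breg sq by (intro mult_right_mono mult_nonneg_nonneg) auto
    ultimately show ?thesis by (simp add: algebra_simps)
  qed
  then have "(\<Sum>j\<in>UNIV. p j * exp (u j) * (A $ i $ j)\<^sup>2) \<le>
    (\<Sum>j\<in>UNIV. 2 * ln 2 * (p j * (A $ i $ j)\<^sup>2) + 2 * M\<^sup>2 * (p j * (exp (u j) - 1 - u j)))"
    by (intro sum_mono)
  also have "\<dots> = 2 * ln 2 * (\<Sum>j\<in>UNIV. p j * (A $ i $ j)\<^sup>2) +
    2 * M\<^sup>2 * (\<Sum>j\<in>UNIV. p j * (exp (u j) - 1 - u j))"
    by (simp add: sum.distrib sum_distrib_left)
  finally have "(\<Sum>j\<in>UNIV. p j * exp (u j) * (A $ i $ j)\<^sup>2) / \<gamma> \<le>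
    (2 * ln 2 * (\<Sum>j\<in>UNIV. p j * (A $ i $ j)\<^sup>2) +
      2 * M\<^sup>2 * (\<Sum>j\<in>UNIV. p j * (exp (u j) - 1 - u j))) / \<gamma>"
    using \<gamma> by (intro divide_right_mono) auto
  also have "\<dots> = 2 * ln 2 * ((\<Sum>j\<in>UNIV. p j * (A $ i $ j)\<^sup>2) / \<gamma>) +
    nu A \<gamma> i * (\<gamma> * (\<Sum>j\<in>UNIV. p j * (exp (u j) - 1 - u j)))"
    using \<gamma> by (simp add: nu_def M_def power2_eq_square add_divide_distrib)
  finally show ?thesis
    using \<gamma> by (simp add: partial_deriv_twice_sum_exp_dual weights gap p_def)
qed

lemma second_derivative_le_H_rng:
  assumes \<gamma>: "0 < \<gamma>" and "standing_assumption A b"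
    and feas: "A *v dual_weights A c \<gamma> s = b"
  shows "partial_deriv i (partial_deriv i (sum_exp_dual A b c \<gamma>)) s \<le> H_rng A b \<gamma> i"
proof -
  have mean: "b $ i = (\<Sum>j\<in>UNIV. dual_weights A c \<gamma> s $ j * A $ i $ j)"
    by (subst feas[symmetric]) (simp add: matrix_vector_mult_def mult_ac)
  have "(\<Sum>j\<in>UNIV. dual_weights A c \<gamma> s $ j * (A $ i $ j)\<^sup>2) \<le> range_mu A b i"
    unfolding range_mu_def mean
    by (rule second_moment_le_range)
      (simp_all add: dual_weights_def[of A c \<gamma> s] row_min_le row_max_ge
        standing_assumption_sum_eq_1[OF assms(2) feas, unfolded dual_weights_def, simplified])
  then show ?thesis
    using \<gamma> by (simp add: partial_deriv_twice_sum_exp_dual H_rng_def divide_right_mono)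
qed

lemma H_rng_le_infnorm:
  assumes \<gamma>: "0 < \<gamma>" and sa: "standing_assumption A b"
  shows "H_rng A b \<gamma> i \<le> (infnorm (row i A))\<^sup>2 / \<gamma>"
proof -
  obtain x where x: "\<And>j. 0 < x $ j" and b: "A *v x = b"
    using sa by (auto simp: standing_assumption_def)
  have mean: "b $ i = (\<Sum>j\<in>UNIV. x $ j * A $ i $ j)"
    by (subst b[symmetric]) (simp add: matrix_vector_mult_def mult_ac)
  have sum: "(\<Sum>j\<in>UNIV. x $ j) = 1"
    by (rule standing_assumption_sum_eq_1[OF sa b])
  have "row_min A i \<le> b $ i" "b $ i \<le> row_max A i"
    unfolding mean using x sum
    by (intro average_in_range[where lo = "row_min A i" and hi = "row_max A i"];
        simp add: row_min_le row_max_ge less_imp_le)+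
  moreover have "\<bar>row_min A i\<bar> \<le> infnorm (row i A)" "\<bar>row_max A i\<bar> \<le> infnorm (row i A)"
    using row_min_attained[of A i] row_max_attained[of A i] abs_entry_le_infnorm_row by metis+
  ultimately have "range_mu A b i \<le> (infnorm (row i A))\<^sup>2"
    unfolding range_mu_def by (rule range_bound_le_square)
  then show ?thesis using \<gamma> by (simp add: H_rng_def divide_right_mono)
qed

theorem corollary3p2:
  fixes A :: "real ^ 'n ^ 'm" and b :: "real ^ 'm" and c :: "real ^ 'n"
    and \<gamma> :: real and i :: 'm
  assumes "\<gamma> > 0"
    and "standing_assumption A b"
  shows "(\<forall>lstar. is_arg_min (sum_exp_dual A b c \<gamma>) (\<lambda>_. True) lstar \<longrightarrow>
             0 \<le> hessian (sum_exp_dual A b c \<gamma>) lstar $ i $ i \<and>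
             hessian (sum_exp_dual A b c \<gamma>) lstar $ i $ i \<le> H_rng A b \<gamma> i) \<and>
         H_rng A b \<gamma> i \<le> (infnorm (row i A))\<^sup>2 / \<gamma> \<and>
         (\<forall>l. partial_deriv i (partial_deriv i (sum_exp_dual A b c \<gamma>)) l
                \<le> kappa A b \<gamma> i + nu A \<gamma> i * dual_gap A b c \<gamma> l) \<and>
         (row_min A i = 0 \<longrightarrow> H_rng A b \<gamma> i = infnorm (row i A) * b $ i / \<gamma>)"
proof (intro conjI allI impI)
  fix s
  assume "is_arg_min (sum_exp_dual A b c \<gamma>) (\<lambda>_. True) s"
  then have "A *v dual_weights A c \<gamma> s = b"
    using assms(1) by (intro minimizer_weights_feasible) (auto simp: is_arg_min_linorder)
  then show "hessian (sum_exp_dual A b c \<gamma>) s $ i $ i \<le> H_rng A b \<gamma> i"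
    using second_derivative_le_H_rng[OF assms] by (simp add: hessian_def)
  show "0 \<le> hessian (sum_exp_dual A b c \<gamma>) s $ i $ i"
    using assms(1)
    by (simp add: hessian_def partial_deriv_twice_sum_exp_dual dual_weights_def sum_nonneg)
next
  show "H_rng A b \<gamma> i \<le> (infnorm (row i A))\<^sup>2 / \<gamma>"
    using assms by (rule H_rng_le_infnorm)
next
  fix l
  let ?\<phi> = "sum_exp_dual A b c \<gamma>"
  obtain x where "\<And>j. 0 < x $ j" and "A *v x = b"
    using assms(2) by (auto simp: standing_assumption_def)
  then obtain s where min: "\<And>l. ?\<phi> s \<le> ?\<phi> l"
    using sum_exp_dual_attains_min[OF assms(1)] by metis
  have "(INF l'. ?\<phi> l') = ?\<phi> s"
    by (rule cInf_eq_minimum) (auto simp: min)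
  then have gap: "dual_gap A b c \<gamma> l = ?\<phi> l - ?\<phi> s"
    by (simp add: dual_gap_def)
  have feas: "A *v dual_weights A c \<gamma> s = b"
    using assms(1) min by (intro minimizer_weights_feasible) auto
  have "2 * ln 2 * partial_deriv i (partial_deriv i ?\<phi>) s \<le> kappa A b \<gamma> i"
    unfolding kappa_def
    by (intro mult_left_mono second_derivative_le_H_rng[OF assms feas]) auto
  then show "partial_deriv i (partial_deriv i ?\<phi>) l \<le> kappa A b \<gamma> i + nu A \<gamma> i * dual_gap A b c \<gamma> l"
    using second_derivative_le_gap[OF assms(1) feas, of i l] unfolding gap by linarith
next
  assume "row_min A i = 0"
  then show "H_rng A b \<gamma> i = infnorm (row i A) * b $ i / \<gamma>"
    by (simp add: H_rng_def range_mu_def infnorm_row_eq_row_max)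
qed

end
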